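(* Let $p\ge 1$ be an integer. Then, as $x\to\infty$, $$\sum_{i,j\le x}([i,j]^{\ast\ast})^p=\frac{\beta_p}{(p+1)^2}\,x^{2(p+1)}+O(x^{2p+1}(\log x)^2),$$ where $$\beta_p:=\zeta(2)\zeta(p+2)\prod_{q}\left(1-\frac{2}{q^2}+\frac{2}{q^3}-\frac1{q^4}-\frac{2}{q^{p+3}}+\frac{2}{q^{p+4}}\right),$$ the product being over all primes $q$.
   Context: A positive divisor $d$ of a positive integer $n$ is a unitary divisor of $n$, written $d\parallel n$, if $\gcd(d,n/d)=1$. For positive integers $i,j$, $(i,j)^{\ast\ast}$ is the greatest common unitary divisor of $i$ and $j$ (the largest $d$ with $d\parallel i$ and $d\parallel j$), and $[i,j]^{\ast\ast}=ij/(i,j)^{\ast\ast}$ (the pseudo least common unitary multiple). The sum is over all ordered pairs of positive integers $i,j\le x$, and $\zeta$ is the Riemann zeta function. The implied constant may depend on $p$. *)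

theory Defs
  imports "HOL-Analysis.Analysis" "HOL-Computational_Algebra.Primes" "HOL-Library.Landau_Symbols"
begin

definition unitary_dvd :: "nat \<Rightarrow> nat \<Rightarrow> bool" where
  "unitary_dvd d n \<longleftrightarrow> d dvd n \<and> coprime d (n div d)"

definition gcud :: "nat \<Rightarrow> nat \<Rightarrow> nat" where
  "gcud i j = Max {d. unitary_dvd d i \<and> unitary_dvd d j}"

lemma unitary_dvd_one: "unitary_dvd 1 n"
  by (simp add: unitary_dvd_def)

lemma
  assumes "i > 0"
  shows unitary_dvd_gcud1: "unitary_dvd (gcud i j) i"
    and unitary_dvd_gcud2: "unitary_dvd (gcud i j) j"
    and gcud_greatest: "unitary_dvd d i \<Longrightarrow> unitary_dvd d j \<Longrightarrow> d \<le> gcud i j"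
proof -
  let ?S = "{d. unitary_dvd d i \<and> unitary_dvd d j}"
  have fin: "finite ?S"
    using assms by (intro finite_subset[of ?S "{..i}"]) (auto simp: unitary_dvd_def dvd_imp_le)
  moreover have "1 \<in> ?S"
    using unitary_dvd_one by simp
  ultimately have "Max ?S \<in> ?S"
    by (intro Max_in) auto
  then show "unitary_dvd (gcud i j) i" "unitary_dvd (gcud i j) j"
    by (simp_all add: gcud_def)
  show "d \<le> gcud i j" if "unitary_dvd d i" "unitary_dvd d j"
    unfolding gcud_def using fin that by (intro Max_ge) auto
qed

text \<open>The division is exact for \<open>i > 0\<close>, since \<open>gcud i j\<close> divides \<open>i\<close>.\<close>

definition lcum :: "nat \<Rightarrow> nat \<Rightarrow> nat" where
  "lcum i j = i * j div gcud i j"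

lemma of_nat_lcum:
  assumes "i > 0"
  shows "real (lcum i j) = real i * real j / real (gcud i j)"
  using unitary_dvd_gcud1[OF assms, of j]
  by (simp add: lcum_def unitary_dvd_def real_of_nat_div)

text \<open>The Dirichlet series of the Riemann zeta function; it represents it only for \<open>s > 1\<close>.\<close>

definition zeta :: "real \<Rightarrow> real" where
  "zeta s = (\<Sum>n. 1 / real (Suc n) powr s)"

definition beta_factor :: "nat \<Rightarrow> real \<Rightarrow> real" where
  "beta_factor p q = 1 - 2 / q ^ 2 + 2 / q ^ 3 - 1 / q ^ 4 - 2 / q ^ (p + 3) + 2 / q ^ (p + 4)"

text \<open>The product over all primes is taken in increasing order, the indices that are not prime
  contributing a factor 1. It converges absolutely, as shown below.\<close>

definition beta_const :: "nat \<Rightarrow> real" where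
  "beta_const p = zeta 2 * zeta (real p + 2) *
     (\<Prod>q. if prime q then beta_factor p (real q) else 1)"

lemma abs_convergent_prod_beta:
  "abs_convergent_prod (\<lambda>q. if prime q then beta_factor p (real q) else 1)"
proof -
  have bound: "\<bar>beta_factor p x - 1\<bar> \<le> 9 / x ^ 2" if x: "x \<ge> 1" for x :: real
  proof -
    have *: "1 / x ^ k \<le> 1 / x ^ 2" "0 \<le> 1 / x ^ k" if "k \<ge> 2" for k
      using x that by (auto intro!: divide_left_mono power_increasing)
    have "\<bar>beta_factor p x - 1\<bar> \<le> 2 * (1 / x^2) + 2 * (1 / x^3) + 1 / x^4 +
        2 * (1 / x^(p+3)) + 2 * (1 / x^(p+4))"
      using *(2)[of 2] *(2)[of 3] *(2)[of 4] *(2)[of "p+3"] *(2)[of "p+4"]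
      unfolding beta_factor_def by linarith
    also have "\<dots> \<le> 9 * (1 / x ^ 2)"
      using *(1)[of 3] *(1)[of 4] *(1)[of "p+3"] *(1)[of "p+4"] by linarith
    finally show ?thesis by simp
  qed
  have "summable (\<lambda>n. 9 * inverse (real n ^ 2))"
    by (intro summable_mult inverse_power_summable) simp
  then have "summable (\<lambda>q. norm ((if prime q then beta_factor p (real q) else 1) - 1))"
  proof (rule summable_comparison_test'[where N = 0])
    show "norm (norm ((if prime q then beta_factor p (real q) else 1) - 1)) \<le>
        9 * inverse (real q ^ 2)" for q :: nat
      using bound[of "real q"] prime_gt_0_nat[of q] by (auto simp: divide_inverse)
  qed
  then show ?thesis
    by (simp add: abs_convergent_prod_conv_summable)
qed

end

theory Submission
  imports Defs
begin

text \<open>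
  Writing \<open>[i,j]\<^sup>p = i\<^sup>p j\<^sup>p / g\<^sup>p\<close> with \<open>g\<close> the greatest common unitary divisor, the only coupling
  between \<open>i\<close> and \<open>j\<close> is the factor \<open>g\<^sup>-\<^sup>p\<close>. Unitary Moebius inversion removes it: there is a
  multiplicative \<open>h\<close> with \<open>n\<^sup>-\<^sup>p = \<Sum>h(d)\<close>, the sum being over the unitary divisors \<open>d\<close> of \<open>n\<close>
  (\<open>sum_unitary_coeff\<close>), and the unitary divisors of \<open>g\<close> are exactly the common unitary divisors of
  \<open>i\<close> and \<open>j\<close> (\<open>unitary_dvd_gcud_iff\<close>). So the double sum equals
  \<open>\<Sum>\<^bsub>d \<le> x\<^esub> h(d) A\<^sub>d(x)\<^sup>2\<close>, where \<open>A\<^sub>d(x)\<close> is the sum of \<open>i\<^sup>p\<close> over the \<open>i \<le> x\<close> having \<open>d\<close> as a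
  unitary divisor (\<open>sum_lcum_power_eq\<close>).

  The substitution \<open>i = d a\<close> with \<open>a\<close> coprime to \<open>d\<close> reduces \<open>A\<^sub>d\<close> to a sieve by the primes dividing
  \<open>d\<close>. With \<open>\<rho>(d) = \<Prod>\<^bsub>q|d\<^esub> (1 - 1/q)\<close> and \<open>\<omega>(d)\<close> the number of primes dividing \<open>d\<close>, it gives
  \<open>A\<^sub>d(x) = \<rho>(d) x\<^bsup>p+1\<^esup> / ((p+1) d) + O(2\<^bsup>\<omega>(d)\<^esup> x\<^sup>p)\<close>, with a constant that does not depend on
  \<open>d\<close> (\<open>unitary_power_sum_asymp\<close>). As both \<open>A\<^sub>d(x)\<close> and its main term are at most
  \<open>x\<^bsup>p+1\<^esup> / d\<close>, squaring costs an error \<open>O(x\<^bsup>2p+1\<^esup> 2\<^bsup>\<omega>(d)\<^esup> / d)\<close>. Since \<open>2\<^bsup>\<omega>(d)\<^esup>\<close> is at most the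
  number of divisors of \<open>d\<close>, the sum of \<open>2\<^bsup>\<omega>(d)\<^esup> / d\<close> over \<open>d \<le> x\<close> is at most the square of a
  harmonic sum, which is where the factor \<open>(log x)\<^sup>2\<close> comes from (\<open>sum_two_power_omega_div_le\<close>).

  The main terms add up to \<open>x\<^bsup>2p+2\<^esup> / (p+1)\<^sup>2\<close> times a partial sum of the absolutely convergent
  series \<open>\<Sum> h(d) \<rho>(d)\<^sup>2 / d\<^sup>2\<close>. Its tail is \<open>O(1/x)\<close>, and its terms are multiplicative, so that it has
  an Euler product (\<open>euler_product\<close>). Each Euler factor is the factor of the given product
  times the Euler factors of \<open>\<zeta>(2)\<close> and \<open>\<zeta>(p+2)\<close>, so the series equals \<open>\<beta>\<^sub>p\<close>
  (\<open>suminf_main_coeff\<close>).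
\<close>

section \<open>Unitary divisors and unitary Moebius inversion\<close>

text \<open>A prime dividing both \<open>lcm a b\<close> and its cofactor would divide \<open>a\<close> or \<open>b\<close>, say \<open>a\<close>; but the
  cofactor of \<open>lcm a b\<close> divides the cofactor of \<open>a\<close>, which is coprime to \<open>a\<close>.\<close>

lemma unitary_dvd_lcm:
  assumes "n > 0" "unitary_dvd a n" "unitary_dvd b n"
  shows "unitary_dvd (lcm a b) n"
proof -
  have l: "lcm a b dvd n"
    using assms by (simp add: unitary_dvd_def)
  have "coprime (n div lcm a b) c" if c: "c dvd n" "coprime c (n div c)" "c dvd lcm a b" for c
  proof -
    have "n div lcm a b dvd n div c"
    proof -
      obtain u where u: "lcm a b = c * u" using c(3) by blast
      obtain v where v: "n = lcm a b * v" using l by blast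
      have "n div lcm a b = v" "n div c = u * v"
        using u v assms(1) by auto
      then show ?thesis by simp
    qed
    then show ?thesis
      using c(2) by (meson coprime_commute coprime_divisors dvd_refl)
  qed
  from this[of a] this[of b] assms(2,3)
  have "coprime (n div lcm a b) (a * b)"
    by (simp add: unitary_dvd_def)
  then have "coprime (n div lcm a b) (lcm a b)"
    by (meson coprime_divisors dvd_refl dvd_triv_left dvd_triv_right lcm_least)
  with l show ?thesis by (simp add: unitary_dvd_def coprime_commute)
qed

lemma unitary_dvd_trans:
  assumes "n > 0" "unitary_dvd d g" "unitary_dvd g n"
  shows "unitary_dvd d n"
proof -
  obtain u where u: "g = d * u" using assms by (auto simp: unitary_dvd_def)
  obtain v where v: "n = g * v" using assms by (auto simp: unitary_dvd_def)
  from u v assms have "coprime d u" "coprime (d * u) v" "n div d = u * v"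
    by (auto simp: unitary_dvd_def)
  with u v show ?thesis by (simp add: unitary_dvd_def)
qed

lemma unitary_dvd_between:
  assumes "n > 0" "unitary_dvd d n" "d dvd g" "g dvd n"
  shows "unitary_dvd d g"
proof -
  obtain u where u: "g = d * u" using assms by auto
  obtain v where v: "n = g * v" using assms by auto
  from u v assms have "coprime d (u * v)"
    by (auto simp: unitary_dvd_def)
  with u assms v show ?thesis by (auto simp add: unitary_dvd_def)
qed

text \<open>The maximum in the definition of \<open>gcud\<close> is taken for the usual order. It is also a
  maximum for divisibility, because the least common multiple of two common unitary divisors is
  again one.\<close>

lemma unitary_dvd_gcud_iff:
  assumes "i > 0" "j > 0"
  shows "unitary_dvd d (gcud i j) \<longleftrightarrow> unitary_dvd d i \<and> unitary_dvd d j"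
proof
  note g = unitary_dvd_gcud1[OF assms(1), of j] unitary_dvd_gcud2[OF assms(1), of j]
  show "unitary_dvd d i \<and> unitary_dvd d j" if "unitary_dvd d (gcud i j)"
    using that g assms by (blast intro: unitary_dvd_trans)
  assume d: "unitary_dvd d i \<and> unitary_dvd d j"
  let ?l = "lcm d (gcud i j)"
  have pos: "?l > 0"
    using d g assms by (auto simp: unitary_dvd_def intro!: Nat.gr0I)
  have "unitary_dvd ?l i" "unitary_dvd ?l j"
    using d g assms by (auto intro: unitary_dvd_lcm)
  then have "?l \<le> gcud i j"
    by (rule gcud_greatest[OF assms(1)])
  then have "?l = gcud i j"
    using pos by (meson dvd_imp_le dvd_lcm2 le_antisym le_zero_eq not_gr_zero le_less_trans
        linorder_not_le nat_less_le dvd_pos_nat)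
  then have "d dvd gcud i j" by (metis dvd_lcm1)
  then show "unitary_dvd d (gcud i j)"
    using d g assms by (auto intro: unitary_dvd_between simp: unitary_dvd_def[of "gcud i j"])
qed

text \<open>The unitary divisors of \<open>n\<close> arise by keeping or dropping each full prime power in its
  factorization, so they correspond to the sets \<open>P\<close> of primes dividing \<open>n\<close>.\<close>

definition unitary_part :: "nat set \<Rightarrow> nat \<Rightarrow> nat" where
  "unitary_part P n = (\<Prod>q\<in>P. q ^ multiplicity q n)"

lemma multiplicity_unitary_part:
  assumes "P \<subseteq> prime_factors n" "prime q"
  shows "multiplicity q (unitary_part P n) = (if q \<in> P then multiplicity q n else 0)"
  unfolding unitary_part_def
  by (rule multiplicity_prod_prime_powers) (use assms finite_subset in auto)

lemma prime_factors_unitary_part: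
  assumes "P \<subseteq> prime_factors n"
  shows "prime_factors (unitary_part P n) = P"
proof -
  have "q \<in> P \<Longrightarrow> prime q \<and> multiplicity q n > 0" for q
    using assms by (auto simp: prime_factors_multiplicity)
  then show ?thesis
    by (auto simp: prime_factors_multiplicity multiplicity_unitary_part[OF assms] split: if_splits)
qed

lemma bij_betw_unitary_part:
  assumes "n > 0"
  shows "bij_betw (\<lambda>P. unitary_part P n) (Pow (prime_factors n)) {d. unitary_dvd d n}"
proof (rule bij_betwI[where g = prime_factors])
  show "(\<lambda>P. unitary_part P n) \<in> Pow (prime_factors n) \<rightarrow> {d. unitary_dvd d n}"
  proof clarify
    fix P assume P: "P \<subseteq> prime_factors n"
    let ?Q = "prime_factors n - P"
    have "n = unitary_part (prime_factors n) n"
      unfolding unitary_part_def by (rule prime_factorization_nat[OF assms])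
    also have "\<dots> = unitary_part ?Q n * unitary_part P n"
      unfolding unitary_part_def using P by (intro prod.subset_diff) auto
    finally have n: "n = unitary_part ?Q n * unitary_part P n" .
    have "coprime (unitary_part P n) (unitary_part ?Q n)"
      unfolding unitary_part_def using P
      by (intro prod_coprime_left prod_coprime_right)
         (auto intro!: primes_coprime dest!: in_prime_factors_imp_prime simp: subset_iff)
    moreover have "n div unitary_part P n = unitary_part ?Q n"
      using n assms by (metis nonzero_mult_div_cancel_right mult_0_right less_irrefl)
    ultimately show "unitary_dvd (unitary_part P n) n"
      using n by (metis dvd_triv_right unitary_dvd_def)
  qed
  show "prime_factors \<in> {d. unitary_dvd d n} \<rightarrow> Pow (prime_factors n)"
    using assms by (auto simp: unitary_dvd_def intro: dvd_trans dest!: dvd_prime_factors[rotated])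
  show "prime_factors (unitary_part P n) = P" if "P \<in> Pow (prime_factors n)" for P
    using that by (simp add: prime_factors_unitary_part)
  show "unitary_part (prime_factors d) n = d" if "d \<in> {d. unitary_dvd d n}" for d
  proof -
    from that obtain u where u: "n = d * u" "coprime d u"
      using assms by (auto simp: unitary_dvd_def)
    then have pos: "d > 0" "u > 0" using assms by auto
    have "multiplicity q n = multiplicity q d" if "q \<in> prime_factors d" for q
    proof -
      have q: "prime q" "q dvd d" using that by auto
      then have "\<not> q dvd u"
        using u(2) by (meson coprime_common_divisor not_prime_unit)
      then show ?thesis
        using q pos u by (simp add: prime_elem_multiplicity_mult_distrib not_dvd_imp_multiplicity_0)
    qed
    then show ?thesis
      using prime_factorization_nat[OF pos(1)] by (simp add: unitary_part_def)
  qed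
qed

lemma card_unitary_divisors:
  assumes "n > 0"
  shows "card {d. unitary_dvd d n} = 2 ^ card (prime_factors n)"
  using bij_betw_same_card[OF bij_betw_unitary_part[OF assms]] by (simp add: card_Pow)

text \<open>The unitary Moebius inverse of \<open>n\<^sup>-\<^sup>p\<close>: multiplicative, with value \<open>q\<^bsup>-pk\<^esup> - 1\<close> at
  the prime power \<open>q\<^sup>k\<close> for \<open>k > 0\<close>.\<close>

definition unitary_coeff :: "nat \<Rightarrow> nat \<Rightarrow> real" where
  "unitary_coeff p n = (\<Prod>q\<in>prime_factors n. (1 / real q) ^ (p * multiplicity q n) - 1)"

text \<open>Over subsets \<open>P\<close> of the primes dividing \<open>n\<close>, the sum of \<open>\<Prod>\<^bsub>q \<in> P\<^esub> (q\<^bsup>-pk\<^esup> - 1)\<close> is the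
  expansion of a product with factors \<open>(q\<^bsup>-pk\<^esup> - 1) + 1\<close>.\<close>

lemma sum_unitary_coeff:
  assumes "n > 0"
  shows "(\<Sum>d | unitary_dvd d n. unitary_coeff p d) = 1 / real n ^ p"
proof -
  let ?c = "\<lambda>q. (1 / real q) ^ (p * multiplicity q n) - 1"
  have "(\<Sum>d | unitary_dvd d n. unitary_coeff p d) =
      (\<Sum>P\<in>Pow (prime_factors n). unitary_coeff p (unitary_part P n))"
    by (rule sum.reindex_bij_betw[OF bij_betw_unitary_part[OF assms], symmetric])
  also have "\<dots> = (\<Sum>P\<in>Pow (prime_factors n). \<Prod>q\<in>P. ?c q)"
  proof (intro sum.cong refl)
    fix P assume "P \<in> Pow (prime_factors n)"
    then have P: "P \<subseteq> prime_factors n" by simp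
    show "unitary_coeff p (unitary_part P n) = (\<Prod>q\<in>P. ?c q)"
      unfolding unitary_coeff_def prime_factors_unitary_part[OF P]
      using P by (intro prod.cong refl) (auto simp: multiplicity_unitary_part[OF P] in_prime_factors_imp_prime)
  qed
  also have "\<dots> = (\<Prod>q\<in>prime_factors n. ?c q + 1)"
    by (subst prod_add) auto
  also have "\<dots> = 1 / real (\<Prod>q\<in>prime_factors n. q ^ multiplicity q n) ^ p"
    by (simp add: prod_dividef power_divide prod_power_distrib power_mult [symmetric] mult.commute)
  also have "(\<Prod>q\<in>prime_factors n. q ^ multiplicity q n) = n"
    by (rule prime_factorization_nat[OF assms, symmetric])
  finally show ?thesis .
qed

lemma abs_unitary_coeff_le_1: "\<bar>unitary_coeff p n\<bar> \<le> 1"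
  unfolding unitary_coeff_def abs_prod
proof (rule prod_le_1)
  fix q assume "q \<in> prime_factors n"
  then have "real q \<ge> 1"
    by (auto dest!: in_prime_factors_imp_prime simp: Suc_leI prime_gt_0_nat)
  then have "(1 / real q) ^ (p * multiplicity q n) \<in> {0..1}"
    by (auto intro!: power_le_one)
  then show "0 \<le> \<bar>(1 / real q) ^ (p * multiplicity q n) - 1\<bar> \<and>
      \<bar>(1 / real q) ^ (p * multiplicity q n) - 1\<bar> \<le> 1"
    by auto
qed

section \<open>Sums of powers under a sieve\<close>

lemma nat_interval_real: "{i. 0 < i \<and> real i \<le> x} = {1..nat \<lfloor>x\<rfloor>}"
proof (intro set_eqI)
  fix i
  have "real i \<le> x \<longleftrightarrow> i \<le> nat \<lfloor>x\<rfloor>" if "0 < i"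
    using that by linarith
  then show "i \<in> {i. 0 < i \<and> real i \<le> x} \<longleftrightarrow> i \<in> {1..nat \<lfloor>x\<rfloor>}"
    by auto
qed

text \<open>The mean value theorem for \<open>t\<^bsup>p+1\<^esup>\<close>, obtained from the factorization of the difference of
  two powers: each of the \<open>p + 1\<close> terms of the cofactor lies between \<open>x\<^sup>p\<close> and \<open>y\<^sup>p\<close>.\<close>

lemma power_difference_bounds:
  fixes x y :: real
  assumes "0 \<le> x" "x \<le> y"
  shows "(y - x) * (real p + 1) * x ^ p \<le> y ^ (p + 1) - x ^ (p + 1)"
    and "y ^ (p + 1) - x ^ (p + 1) \<le> (y - x) * (real p + 1) * y ^ p"
proof -
  let ?s = "\<Sum>i<Suc p. x ^ (p - i) * y ^ i"
  have diff: "y ^ (p + 1) - x ^ (p + 1) = (y - x) * ?s"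
    using power_diff_sumr2[of y "Suc p" x] by simp
  have terms: "x ^ p \<le> x ^ (p - i) * y ^ i" "x ^ (p - i) * y ^ i \<le> y ^ p" if "i \<in> {..<Suc p}" for i
  proof -
    have p: "z ^ p = z ^ (p - i) * z ^ i" for z :: real
      using that by (simp flip: power_add)
    show "x ^ p \<le> x ^ (p - i) * y ^ i" "x ^ (p - i) * y ^ i \<le> y ^ p"
      unfolding p[of x] p[of y] using assms
      by (auto intro!: mult_left_mono mult_right_mono power_mono)
  qed
  have lo: "(real p + 1) * x ^ p \<le> ?s"
    using sum_bounded_below[of "{..<Suc p}" "x ^ p" "\<lambda>i. x ^ (p - i) * y ^ i", OF terms(1)]
    by (simp add: add.commute del: sum.lessThan_Suc)
  have hi: "?s \<le> (real p + 1) * y ^ p"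
    using sum_bounded_above[of "{..<Suc p}" "\<lambda>i. x ^ (p - i) * y ^ i" "y ^ p", OF terms(2)]
    by (simp add: add.commute del: sum.lessThan_Suc)
  show "(y - x) * (real p + 1) * x ^ p \<le> y ^ (p + 1) - x ^ (p + 1)"
    unfolding diff mult.assoc by (rule mult_left_mono[OF lo]) (use assms in simp)
  show "y ^ (p + 1) - x ^ (p + 1) \<le> (y - x) * (real p + 1) * y ^ p"
    unfolding diff mult.assoc by (rule mult_left_mono[OF hi]) (use assms in simp)
qed

lemma sum_powers_bounds:
  shows "real n ^ (p + 1) / (real p + 1) \<le> (\<Sum>a = 1..n. real a ^ p)"
    and "(\<Sum>a = 1..n. real a ^ p) \<le> real n ^ (p + 1) / (real p + 1) + real n ^ p"
proof (induction n)
  case (Suc n)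
  have step: "real n ^ p \<le> (real (Suc n) ^ (p + 1) - real n ^ (p + 1)) / (real p + 1)"
    "(real (Suc n) ^ (p + 1) - real n ^ (p + 1)) / (real p + 1) \<le> real (Suc n) ^ p"
    using power_difference_bounds[of "real n" "real (Suc n)" p]
    by (auto simp: field_simps)
  {
    case 1
    show ?case using Suc(1) step(2) by (simp add: diff_divide_distrib)
  next
    case 2
    show ?case using Suc(2) step(1) by (simp add: diff_divide_distrib)
  }
qed simp_all

definition sifted_power_sum :: "nat \<Rightarrow> nat set \<Rightarrow> real \<Rightarrow> real" where
  "sifted_power_sum p P y = (\<Sum>a | 0 < a \<and> real a \<le> y \<and> (\<forall>q\<in>P. \<not> q dvd a). real a ^ p)"

lemma finite_sifted: "finite {a. 0 < a \<and> real a \<le> y \<and> Q a}"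
  by (rule finite_subset[of _ "{a. 0 < a \<and> real a \<le> y}"]) (blast, simp add: nat_interval_real)

lemma sifted_power_sum_empty:
  assumes "y \<ge> 0"
  shows "\<bar>sifted_power_sum p {} y - y ^ (p + 1) / (real p + 1)\<bar> \<le> y ^ p"
proof -
  define n where "n = nat \<lfloor>y\<rfloor>"
  have n: "real n \<le> y" "y \<le> real n + 1"
    using assms unfolding n_def by linarith+
  have eq: "sifted_power_sum p {} y = (\<Sum>a = 1..n. real a ^ p)"
    by (simp add: sifted_power_sum_def nat_interval_real n_def)
  \<comment> \<open>Passing from \<open>n = \<lfloor>y\<rfloor>\<close> to \<open>y\<close> changes the main term by at most \<open>y\<^sup>p\<close>, as \<open>y - n \<le> 1\<close>.\<close>
  have "y ^ (p + 1) - real n ^ (p + 1) \<le> (y - real n) * (real p + 1) * y ^ p"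
    using power_difference_bounds(2)[of "real n" y p] n by simp
  also have "\<dots> \<le> 1 * (real p + 1) * y ^ p"
    using n assms by (intro mult_right_mono) auto
  finally have "(y ^ (p + 1) - real n ^ (p + 1)) / (real p + 1) \<le> y ^ p"
    by (simp add: field_simps)
  moreover have "real n ^ (p + 1) / (real p + 1) \<le> y ^ (p + 1) / (real p + 1)"
    using n by (intro divide_right_mono power_mono) auto
  moreover have "real n ^ p \<le> y ^ p"
    using n by (intro power_mono) auto
  ultimately show ?thesis
    unfolding eq using sum_powers_bounds[where n = n and p = p] by (simp add: diff_divide_distrib)
qed

text \<open>The multiples of \<open>q\<close> that survive the sieve by \<open>P\<close> are the \<open>q b\<close> with \<open>b\<close> surviving it up to
  \<open>y / q\<close>, since \<open>q\<close> is divisible by no prime of \<open>P\<close>.\<close>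

lemma sifted_power_sum_insert:
  assumes "prime q" "q \<notin> P" "\<And>r. r \<in> P \<Longrightarrow> prime r"
  shows "sifted_power_sum p (insert q P) y =
    sifted_power_sum p P y - real q ^ p * sifted_power_sum p P (y / real q)"
proof -
  let ?A = "\<lambda>P y. {a. 0 < a \<and> real a \<le> y \<and> (\<forall>q\<in>P. \<not> q dvd a)}"
  have q: "q > 0" using assms(1) by (rule prime_gt_0_nat)
  have split: "?A P y = ?A (insert q P) y \<union> (\<lambda>a. q * a) ` ?A P (y / real q)"
  proof (intro equalityI subsetI)
    fix a assume a: "a \<in> ?A P y"
    show "a \<in> ?A (insert q P) y \<union> (\<lambda>a. q * a) ` ?A P (y / real q)"
    proof (cases "q dvd a")
      case True
      then obtain b where b: "a = q * b" by blast
      then have "b \<in> ?A P (y / real q)"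
        using a q by (auto simp: field_simps)
      then show ?thesis using b by blast
    qed (use a in auto)
  next
    fix a assume "a \<in> ?A (insert q P) y \<union> (\<lambda>a. q * a) ` ?A P (y / real q)"
    then show "a \<in> ?A P y"
    proof
      assume "a \<in> (\<lambda>a. q * a) ` ?A P (y / real q)"
      then obtain b where b: "a = q * b" "b \<in> ?A P (y / real q)" by blast
      have "\<not> r dvd q * b" if "r \<in> P" for r
        using that b assms by (metis (mono_tags, lifting) mem_Collect_eq prime_dvd_mult_iff primes_dvd_imp_eq)
      then show ?thesis using b q by (auto simp: field_simps)
    qed auto
  qed
  have "sifted_power_sum p P y =
      sifted_power_sum p (insert q P) y + (\<Sum>a\<in>(\<lambda>a. q * a) ` ?A P (y / real q). real a ^ p)"
    unfolding sifted_power_sum_def split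
    by (rule sum.union_disjoint) (auto simp: finite_sifted)
  also have "(\<Sum>a\<in>(\<lambda>a. q * a) ` ?A P (y / real q). real a ^ p) =
      real q ^ p * sifted_power_sum p P (y / real q)"
    using q by (subst sum.reindex)
      (auto simp: inj_on_def sifted_power_sum_def sum_distrib_left power_mult_distrib)
  finally show ?thesis by simp
qed

text \<open>Sieving by one more prime \<open>q\<close> subtracts \<open>q\<^sup>p\<close> times the same problem at \<open>y / q\<close>. The
  factors \<open>q\<^sup>p\<close> and \<open>(y / q)\<^sup>p\<close> recombine to \<open>y\<^sup>p\<close>, so the error bound exactly doubles, whatever the size
  of \<open>q\<close>. This uniformity in \<open>P\<close> is what allows the later summation over \<open>d\<close>.\<close>

lemma sifted_power_sum_asymp:
  assumes "finite P" "\<And>q. q \<in> P \<Longrightarrow> prime q" "y \<ge> 0"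
  shows "\<bar>sifted_power_sum p P y - (\<Prod>q\<in>P. 1 - 1 / real q) * y ^ (p + 1) / (real p + 1)\<bar>
    \<le> 2 ^ card P * y ^ p"
  using assms
proof (induction P arbitrary: y rule: finite_induct)
  case empty
  then show ?case using sifted_power_sum_empty[of y p] by simp
next
  case (insert q P)
  have q: "prime q" "real q > 0" using insert.prems by (auto simp: prime_gt_0_nat)
  define M where "M = (\<lambda>z. (\<Prod>q\<in>P. 1 - 1 / real q) * z ^ (p + 1) / (real p + 1))"
  have IH: "\<bar>sifted_power_sum p P z - M z\<bar> \<le> 2 ^ card P * z ^ p" if "z \<ge> 0" for z
    using insert.IH[of z] insert.prems that unfolding M_def by blast
  have "sifted_power_sum p (insert q P) y =
      sifted_power_sum p P y - real q ^ p * sifted_power_sum p P (y / real q)"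
    using insert.prems insert.hyps by (intro sifted_power_sum_insert) auto
  moreover have "(\<Prod>q\<in>insert q P. 1 - 1 / real q) * y ^ (p + 1) / (real p + 1) =
      M y - real q ^ p * M (y / real q)"
    using insert.hyps q(2) unfolding M_def power_divide
    by (subst prod.insert) (simp_all add: right_diff_distrib left_diff_distrib diff_divide_distrib)
  ultimately have "\<bar>sifted_power_sum p (insert q P) y -
        (\<Prod>q\<in>insert q P. 1 - 1 / real q) * y ^ (p + 1) / (real p + 1)\<bar> =
      \<bar>(sifted_power_sum p P y - M y) - real q ^ p * (sifted_power_sum p P (y / real q) - M (y / real q))\<bar>"
    by (simp only:) (simp add: algebra_simps)
  also have "\<dots> \<le> \<bar>sifted_power_sum p P y - M y\<bar> +
      real q ^ p * \<bar>sifted_power_sum p P (y / real q) - M (y / real q)\<bar>"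
    by (rule order_trans[OF abs_triangle_ineq4]) (simp add: abs_mult)
  also have "\<dots> \<le> 2 ^ card P * y ^ p + real q ^ p * (2 ^ card P * (y / real q) ^ p)"
    using insert.prems q by (intro add_mono mult_left_mono IH) auto
  also have "\<dots> = 2 ^ card (insert q P) * y ^ p"
    using insert.hyps q by (simp add: power_divide)
  finally show ?case .
qed

lemma sifted_power_sum_le:
  assumes "y \<ge> 0"
  shows "sifted_power_sum p P y \<le> y ^ (p + 1)"
proof -
  have "sifted_power_sum p P y \<le> (\<Sum>a | 0 < a \<and> real a \<le> y. real a ^ p)"
    unfolding sifted_power_sum_def by (intro sum_mono2) (use finite_sifted[of y "\<lambda>_. True"] in auto)
  also have "\<dots> \<le> (\<Sum>a | 0 < a \<and> real a \<le> y. y ^ p)"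
    by (intro sum_mono power_mono) auto
  also have "\<dots> = real (nat \<lfloor>y\<rfloor>) * y ^ p"
    by (simp add: nat_interval_real)
  also have "\<dots> \<le> y * y ^ p"
    using assms by (intro mult_right_mono) auto
  finally show ?thesis by simp
qed

definition unitary_power_sum :: "nat \<Rightarrow> nat \<Rightarrow> real \<Rightarrow> real" where
  "unitary_power_sum p d x = (\<Sum>i | 0 < i \<and> real i \<le> x \<and> unitary_dvd d i. real i ^ p)"

lemma unitary_power_sum_eq:
  assumes "d > 0"
  shows "unitary_power_sum p d x = real d ^ p * sifted_power_sum p (prime_factors d) (x / real d)"
proof -
  let ?A = "{a. 0 < a \<and> real a \<le> x / real d \<and> (\<forall>q\<in>prime_factors d. \<not> q dvd a)}"
  have cop: "coprime d a \<longleftrightarrow> (\<forall>q\<in>prime_factors d. \<not> q dvd a)" for a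
  proof
    show "\<forall>q\<in>prime_factors d. \<not> q dvd a" if "coprime d a"
      using that assms by (auto simp: prime_factors_dvd dest: coprime_common_divisor not_prime_unit)
    show "coprime d a" if "\<forall>q\<in>prime_factors d. \<not> q dvd a"
    proof (rule ccontr)
      assume "\<not> coprime d a"
      then obtain q where "prime q" "q dvd gcd d a"
        using prime_factor_nat[of "gcd d a"] by (auto simp: coprime_iff_gcd_eq_1)
      then show False using that assms by (auto simp: prime_factors_dvd)
    qed
  qed
  have "{i. 0 < i \<and> real i \<le> x \<and> unitary_dvd d i} = (\<lambda>a. d * a) ` ?A"
  proof (intro equalityI subsetI)
    fix i assume i: "i \<in> {i. 0 < i \<and> real i \<le> x \<and> unitary_dvd d i}"
    then obtain a where a: "i = d * a" by (auto simp: unitary_dvd_def)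
    with i have "a \<in> ?A"
      using assms by (auto simp: unitary_dvd_def cop field_simps)
    with a show "i \<in> (\<lambda>a. d * a) ` ?A" by blast
  next
    fix i assume "i \<in> (\<lambda>a. d * a) ` ?A"
    then show "i \<in> {i. 0 < i \<and> real i \<le> x \<and> unitary_dvd d i}"
      using assms by (auto simp: unitary_dvd_def cop field_simps)
  qed
  then show ?thesis
    unfolding unitary_power_sum_def sifted_power_sum_def
    by (simp add: sum.reindex inj_on_def assms sum_distrib_left power_mult_distrib)
qed

definition sieve_density :: "nat \<Rightarrow> real" where
  "sieve_density d = (\<Prod>q\<in>prime_factors d. 1 - 1 / real q)"

lemma sieve_density_bounds: "0 \<le> sieve_density d" "sieve_density d \<le> 1"
proof -
  have "0 \<le> 1 - 1 / real q \<and> 1 - 1 / real q \<le> 1" if "q \<in> prime_factors d" for q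
    using prime_gt_0_nat[OF in_prime_factors_imp_prime[OF that]] by simp
  then show "0 \<le> sieve_density d" "sieve_density d \<le> 1"
    unfolding sieve_density_def by (auto intro!: prod_nonneg prod_le_1)
qed

lemma unitary_power_sum_asymp:
  assumes "d > 0" "x \<ge> 0"
  shows "\<bar>unitary_power_sum p d x - sieve_density d * x ^ (p + 1) / (real p + 1) / real d\<bar>
    \<le> 2 ^ card (prime_factors d) * x ^ p"
proof -
  let ?s = "sifted_power_sum p (prime_factors d) (x / real d)"
  let ?m = "sieve_density d * (x / real d) ^ (p + 1) / (real p + 1)"
  have "sieve_density d * x ^ (p + 1) / (real p + 1) / real d = real d ^ p * ?m"
    using assms by (simp add: power_divide)
  then have "\<bar>unitary_power_sum p d x - sieve_density d * x ^ (p + 1) / (real p + 1) / real d\<bar> =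
      \<bar>real d ^ p * (?s - ?m)\<bar>"
    unfolding unitary_power_sum_eq[OF assms(1)] by (simp only: right_diff_distrib)
  also have "\<dots> = real d ^ p * \<bar>?s - ?m\<bar>"
    by (simp add: abs_mult)
  also have "\<dots> \<le> real d ^ p * (2 ^ card (prime_factors d) * (x / real d) ^ p)"
    unfolding sieve_density_def using assms
    by (intro mult_left_mono sifted_power_sum_asymp) auto
  also have "\<dots> = 2 ^ card (prime_factors d) * x ^ p"
    using assms by (simp add: power_divide)
  finally show ?thesis .
qed

text \<open>The trivial upper bound keeps the factor \<open>1 / d\<close>, which the error term of
  \<open>unitary_power_sum_asymp\<close> does not have; it is needed for the difference of squares.\<close>

lemma unitary_power_sum_bounds:
  assumes "d > 0" "x \<ge> 0"
  shows "0 \<le> unitary_power_sum p d x" "unitary_power_sum p d x \<le> x ^ (p + 1) / real d"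
proof -
  show "0 \<le> unitary_power_sum p d x"
    unfolding unitary_power_sum_def by (intro sum_nonneg) simp
  have "unitary_power_sum p d x \<le> real d ^ p * (x / real d) ^ (p + 1)"
    unfolding unitary_power_sum_eq[OF assms(1)] using assms
    by (intro mult_left_mono sifted_power_sum_le) auto
  also have "\<dots> = x ^ (p + 1) / real d"
    using assms by (simp add: power_divide)
  finally show "unitary_power_sum p d x \<le> x ^ (p + 1) / real d" .
qed

section \<open>Euler products of absolutely convergent multiplicative series\<close>

definition smooth :: "nat set \<Rightarrow> nat set" where
  "smooth P = {n. n > 0 \<and> prime_factors n \<subseteq> P}"

text \<open>Splitting off the power of \<open>q\<close> that divides a number; this is the induction step for Euler
  products.\<close>

lemma bij_betw_smooth_insert:
  assumes "prime q" "q \<notin> P"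
  shows "bij_betw (\<lambda>(k, m). q ^ k * m) (UNIV \<times> smooth P) (smooth (insert q P))"
proof -
  have nd: "\<not> q dvd m" if "m \<in> smooth P" for m
    using that assms by (auto simp: smooth_def prime_factors_dvd)
  show ?thesis
  proof (rule bij_betwI[where g = "\<lambda>n. (multiplicity q n, n div q ^ multiplicity q n)"])
    show "(\<lambda>(k, m). q ^ k * m) \<in> UNIV \<times> smooth P \<rightarrow> smooth (insert q P)"
    proof clarify
      fix k m assume m: "m \<in> smooth P"
      have "r = q" if "prime r" "r dvd q ^ k" for r
        using that assms(1) by (metis prime_dvd_power primes_dvd_imp_eq)
      then show "q ^ k * m \<in> smooth (insert q P)"
        using m assms(1) prime_gt_0_nat[OF assms(1)]
        by (auto simp: smooth_def prime_factors_dvd prime_dvd_mult_iff subset_iff)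
    qed
    show "(\<lambda>n. (multiplicity q n, n div q ^ multiplicity q n)) \<in> smooth (insert q P) \<rightarrow> UNIV \<times> smooth P"
    proof (rule funcsetI)
      fix n assume n: "n \<in> smooth (insert q P)"
      then have "n > 0" by (simp add: smooth_def)
      then obtain y where y: "n = q ^ multiplicity q n * y" "\<not> q dvd y"
        using multiplicity_decompose'[of n q] assms(1) not_prime_unit[of q] by blast
      then have "n div q ^ multiplicity q n = y"
        by (metis \<open>n > 0\<close> less_irrefl mult_0 nonzero_mult_div_cancel_left)
      moreover have "y > 0" using y(2) by (auto intro!: Nat.gr0I)
      moreover have "prime_factors y \<subseteq> P"
      proof
        fix r assume r: "r \<in> prime_factors y"
        have "r dvd n"
          by (subst y(1)) (use r in auto)
        then have "r \<in> prime_factors n"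
          using \<open>n > 0\<close> r by (auto simp: prime_factors_dvd)
        moreover have "r \<noteq> q" using r y(2) by (auto simp: prime_factors_dvd)
        ultimately show "r \<in> P" using n by (auto simp: smooth_def)
      qed
      ultimately show "(multiplicity q n, n div q ^ multiplicity q n) \<in> UNIV \<times> smooth P"
        by (simp add: smooth_def)
    qed
  next
    fix x :: "nat \<times> nat" assume "x \<in> UNIV \<times> smooth P"
    then obtain k m where x: "x = (k, m)" "m \<in> smooth P" by auto
    then have "multiplicity q (q ^ k * m) = k"
      using nd[OF x(2)] assms(1) by (intro multiplicity_eqI) (auto simp: power_add mult.commute)
    then show "(\<lambda>n. (multiplicity q n, n div q ^ multiplicity q n)) ((\<lambda>(k, m). q ^ k * m) x) = x"
      using x assms(1) by auto
  next
    fix n assume "n \<in> smooth (insert q P)"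
    show "(\<lambda>(k, m). q ^ k * m) (multiplicity q n, n div q ^ multiplicity q n) = n"
      by (simp add: multiplicity_dvd)
  qed
qed

lemma infsum_smooth:
  fixes f :: "nat \<Rightarrow> real"
  assumes "finite P" "\<And>q. q \<in> P \<Longrightarrow> prime q"
    and "f 1 = 1"
    and mult: "\<And>q k m. prime q \<Longrightarrow> \<not> q dvd m \<Longrightarrow> f (q ^ k * m) = f (q ^ k) * f m"
    and summable: "f summable_on UNIV"
  shows "infsum f (smooth P) = (\<Prod>q\<in>P. infsum (\<lambda>k. f (q ^ k)) UNIV)"
  using assms(1,2)
proof (induction P rule: finite_induct)
  case empty
  have "smooth {} = {1}"
    by (auto simp: smooth_def prime_factorization_empty_iff)
  with \<open>f 1 = 1\<close> show ?case by simp
next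
  case (insert q P)
  have q: "prime q" using insert by simp
  note bij = bij_betw_smooth_insert[OF q \<open>q \<notin> P\<close>]
  have nd: "\<not> q dvd m" if "m \<in> smooth P" for m
    using that insert.hyps q by (auto simp: smooth_def prime_factors_dvd)
  have "(\<lambda>(k, m). f (q ^ k * m)) summable_on UNIV \<times> smooth P"
    using summable_on_reindex_bij_betw[OF bij, of f] summable_on_subset_banach[OF summable]
    by (simp add: case_prod_unfold)
  then have "(\<Sum>\<^sub>\<infinity>k. \<Sum>\<^sub>\<infinity>m\<in>smooth P. f (q ^ k * m)) = (\<Sum>\<^sub>\<infinity>(k, m)\<in>UNIV \<times> smooth P. f (q ^ k * m))"
    by (rule infsum_Sigma'_banach)
  also have "\<dots> = infsum f (smooth (insert q P))"
    using infsum_reindex_bij_betw[OF bij, of f] by (simp add: case_prod_unfold)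
  finally have "infsum f (smooth (insert q P)) = (\<Sum>\<^sub>\<infinity>k. \<Sum>\<^sub>\<infinity>m\<in>smooth P. f (q ^ k * m))" ..
  also have "\<dots> = (\<Sum>\<^sub>\<infinity>k. \<Sum>\<^sub>\<infinity>m\<in>smooth P. f (q ^ k) * f m)"
    by (intro infsum_cong mult q nd)
  also have "\<dots> = (\<Sum>\<^sub>\<infinity>k. f (q ^ k)) * infsum f (smooth P)"
    by (simp add: infsum_cmult_right' infsum_cmult_left')
  finally show ?case
    using insert by simp
qed

text \<open>The partial product over the primes up to \<open>N\<close> is the sum of \<open>f\<close> over the numbers all of whose
  prime factors are at most \<open>N\<close>. These include \<open>1, \<dots>, N\<close>, so the difference to the full sum is
  bounded by a tail of the absolutely convergent series. The condition \<open>f 0 = 0\<close> makes the sum over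
  all natural numbers one over the positive ones.\<close>

lemma euler_product:
  fixes f :: "nat \<Rightarrow> real"
  assumes "f 0 = 0" "f 1 = 1"
    and mult: "\<And>q k m. prime q \<Longrightarrow> \<not> q dvd m \<Longrightarrow> f (q ^ k * m) = f (q ^ k) * f m"
    and summable: "summable (\<lambda>n. \<bar>f n\<bar>)"
  shows "(\<lambda>N. \<Prod>q\<le>N. if prime q then (\<Sum>k. f (q ^ k)) else 1) \<longlonglongrightarrow> suminf f"
proof -
  have on: "(\<lambda>n. \<bar>f n\<bar>) summable_on A" "f summable_on A" for A
    using norm_summable_imp_summable_on[of f] norm_summable_imp_summable_on[of "\<lambda>n. \<bar>f n\<bar>"] summable
    by (auto intro: summable_on_subset_banach)
  define S where "S N = smooth {q. prime q \<and> q \<le> N}" for N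
  have local_factor: "infsum (\<lambda>k. f (q ^ k)) UNIV = (\<Sum>k. f (q ^ k))" if "prime q" for q
  proof -
    have "inj (\<lambda>k. q ^ k)"
      using prime_gt_1_nat[OF that] by (auto intro!: injI dest: power_inject_exp[THEN iffD1, rotated])
    then have "(\<lambda>k. f (q ^ k)) summable_on UNIV"
      using summable_on_reindex[of "\<lambda>k. q ^ k" UNIV f] on(2) by (simp add: o_def)
    then show ?thesis
      by (intro sums_unique has_sum_imp_sums has_sum_infsum)
  qed
  have prod: "(\<Prod>q\<le>N. if prime q then (\<Sum>k. f (q ^ k)) else 1) = infsum f (S N)" for N
  proof -
    have "infsum f (S N) = (\<Prod>q | prime q \<and> q \<le> N. infsum (\<lambda>k. f (q ^ k)) UNIV)"
      unfolding S_def by (rule infsum_smooth) (use assms on in auto)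
    also have "\<dots> = (\<Prod>q | prime q \<and> q \<le> N. if prime q then (\<Sum>k. f (q ^ k)) else 1)"
      by (intro prod.cong) (auto simp: local_factor)
    also have "\<dots> = (\<Prod>q\<le>N. if prime q then (\<Sum>k. f (q ^ k)) else 1)"
      by (intro prod.mono_neutral_left) auto
    finally show ?thesis ..
  qed
  have total: "infsum f UNIV = suminf f" "infsum (\<lambda>n. \<bar>f n\<bar>) UNIV = (\<Sum>n. \<bar>f n\<bar>)"
    by (intro sums_unique has_sum_imp_sums has_sum_infsum on)+
  have bound: "\<bar>suminf f - infsum f (S N)\<bar> \<le> (\<Sum>n. \<bar>f n\<bar>) - (\<Sum>n\<le>N. \<bar>f n\<bar>)" for N
  proof -
    have "infsum f (UNIV - S N) = suminf f - infsum f (S N)"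
      unfolding total(1)[symmetric] by (intro infsum_Diff on) auto
    then have "\<bar>suminf f - infsum f (S N)\<bar> \<le> infsum (\<lambda>n. \<bar>f n\<bar>) (UNIV - S N)"
      using norm_infsum_bound[of f "UNIV - S N"] on(1) by simp
    also have "\<dots> \<le> infsum (\<lambda>n. \<bar>f n\<bar>) (UNIV - {..N})"
    proof (rule infsum_mono_neutral)
      fix n assume n: "n \<in> (UNIV - S N) - (UNIV - {..N})"
      have "n = 0"
      proof (rule ccontr)
        assume "n \<noteq> 0"
        then have "n \<in> S N"
          using n by (auto simp: S_def smooth_def prime_factors_dvd dest!: dvd_imp_le)
        with n show False by simp
      qed
      then show "\<bar>f n\<bar> \<le> 0" using assms(1) by simp
    qed (auto intro: on)
    also have "\<dots> = infsum (\<lambda>n. \<bar>f n\<bar>) UNIV - infsum (\<lambda>n. \<bar>f n\<bar>) {..N}"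
      by (intro infsum_Diff on) auto
    finally show ?thesis using total(2) by simp
  qed
  have "(\<lambda>N. (\<Sum>n. \<bar>f n\<bar>) - (\<Sum>n\<le>N. \<bar>f n\<bar>)) \<longlonglongrightarrow> (\<Sum>n. \<bar>f n\<bar>) - (\<Sum>n. \<bar>f n\<bar>)"
    by (intro tendsto_diff tendsto_const summable_LIMSEQ' summable)
  then have null: "(\<lambda>N. (\<Sum>n. \<bar>f n\<bar>) - (\<Sum>n\<le>N. \<bar>f n\<bar>)) \<longlonglongrightarrow> 0"
    by simp
  have "(\<lambda>N. suminf f - infsum f (S N)) \<longlonglongrightarrow> 0"
    by (rule Lim_null_comparison[OF _ null]) (simp add: bound)
  from tendsto_diff[OF tendsto_const[of "suminf f"] this]
  show ?thesis by (simp add: prod)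
qed

lemma zeta_euler_product:
  assumes "m \<ge> 2"
  shows "(\<lambda>N. \<Prod>q\<le>N. if prime q then 1 / (1 - 1 / real q ^ m) else 1) \<longlonglongrightarrow> zeta (real m)"
proof -
  define f where "f n = 1 / real n ^ m" for n :: nat
  have summable: "summable f"
    using inverse_power_summable[of m, where 'a = real] assms by (simp add: f_def[abs_def] inverse_eq_divide)
  have f: "f 0 = 0" "f 1 = 1" "\<And>q k m'. f (q ^ k * m') = f (q ^ k) * f m'"
    using assms by (auto simp: f_def power_mult_distrib)
  have "zeta (real m) = (\<Sum>n. f (Suc n))"
    by (simp add: zeta_def f_def powr_realpow del: of_nat_Suc)
  also have "\<dots> = suminf f"
    using suminf_split_head[OF summable] f by simp
  finally have "suminf f = zeta (real m)" ..
  moreover have "(\<Sum>k. f (q ^ k)) = 1 / (1 - 1 / real q ^ m)" if "prime q" for q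
  proof -
    have "f (q ^ k) = (1 / real q ^ m) ^ k" for k
      by (simp add: f_def power_divide mult.commute flip: power_mult)
    moreover have "norm (1 / real q ^ m) < 1"
      using prime_gt_1_nat[OF that] assms by (simp add: one_less_power)
    ultimately show ?thesis
      using suminf_geometric[of "1 / real q ^ m"] by simp
  qed
  moreover have "(\<lambda>N. \<Prod>q\<le>N. if prime q then (\<Sum>k. f (q ^ k)) else 1) \<longlonglongrightarrow> suminf f"
    using f summable by (intro euler_product) (auto simp: f_def[abs_def])
  ultimately show ?thesis
    by (simp cong: if_cong)
qed

section \<open>The series with sum \<open>\<beta>\<^sub>p\<close>\<close>

text \<open>The coefficient of \<open>x\<^bsup>2p+2\<^esup> / (p+1)\<^sup>2\<close> contributed by \<open>d = n\<close>. The value at 0 is 0, by division by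
  zero.\<close>

definition main_coeff :: "nat \<Rightarrow> nat \<Rightarrow> real" where
  "main_coeff p n = unitary_coeff p n * sieve_density n ^ 2 / real n ^ 2"

lemma abs_main_coeff_le: "\<bar>main_coeff p n\<bar> \<le> 1 / real n ^ 2"
proof -
  have "\<bar>unitary_coeff p n\<bar> * sieve_density n ^ 2 \<le> 1"
    using abs_unitary_coeff_le_1 sieve_density_bounds by (intro mult_le_one power_le_one) auto
  then show ?thesis
    by (simp add: main_coeff_def abs_mult divide_right_mono)
qed

lemma summable_abs_main_coeff: "summable (\<lambda>n. \<bar>main_coeff p n\<bar>)"
proof (rule summable_comparison_test')
  show "summable (\<lambda>n. 1 / real n ^ 2)"
    using inverse_power_summable[of 2, where 'a = real] by (simp add: inverse_eq_divide)
qed (use abs_main_coeff_le in auto)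

text \<open>Products of this shape include \<open>unitary_coeff\<close> and \<open>sieve_density\<close>, which makes
  \<open>main_coeff\<close> multiplicative.\<close>

lemma prod_prime_factors_coprime_mult:
  fixes g :: "nat \<Rightarrow> nat \<Rightarrow> 'a :: comm_monoid_mult"
  assumes "a > 0" "b > 0" "coprime a b"
  shows "(\<Prod>q\<in>prime_factors (a * b). g q (multiplicity q (a * b))) =
    (\<Prod>q\<in>prime_factors a. g q (multiplicity q a)) * (\<Prod>q\<in>prime_factors b. g q (multiplicity q b))"
proof -
  have mult: "multiplicity q (a * b) = multiplicity q a + multiplicity q b" if "prime q" for q
    using that assms by (simp add: prime_elem_multiplicity_mult_distrib)
  have disj: "\<not> (q dvd a \<and> q dvd b)" if "prime q" for q
    using that assms(3) by (meson coprime_common_divisor not_prime_unit)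
  then have disj': "prime q \<Longrightarrow> q dvd b \<Longrightarrow> \<not> q dvd a" for q
    by blast
  have "(\<Prod>q\<in>prime_factors (a * b). g q (multiplicity q (a * b))) =
      (\<Prod>q\<in>prime_factors a. g q (multiplicity q (a * b))) * (\<Prod>q\<in>prime_factors b. g q (multiplicity q (a * b)))"
  proof -
    have "prime_factors (a * b) = prime_factors a \<union> prime_factors b"
      using assms by (intro prime_factors_product) auto
    then show ?thesis
      using disj by (simp only:) (intro prod.union_disjoint, auto)
  qed
  moreover have "(\<Prod>q\<in>prime_factors a. g q (multiplicity q (a * b))) = (\<Prod>q\<in>prime_factors a. g q (multiplicity q a))"
    using disj assms by (intro prod.cong refl) (auto simp: mult prime_factors_dvd not_dvd_imp_multiplicity_0)
  moreover have "(\<Prod>q\<in>prime_factors b. g q (multiplicity q (a * b))) = (\<Prod>q\<in>prime_factors b. g q (multiplicity q b))"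
    using disj' assms by (intro prod.cong refl) (auto simp: mult prime_factors_dvd not_dvd_imp_multiplicity_0)
  ultimately show ?thesis by simp
qed

lemma main_coeff_coprime_mult:
  assumes "a > 0" "b > 0" "coprime a b"
  shows "main_coeff p (a * b) = main_coeff p a * main_coeff p b"
  using prod_prime_factors_coprime_mult[OF assms, of "\<lambda>q k. (1 / real q) ^ (p * k) - 1"]
    prod_prime_factors_coprime_mult[OF assms, of "\<lambda>q k. 1 - 1 / real q"]
  by (simp add: main_coeff_def unitary_coeff_def sieve_density_def power_mult_distrib)

text \<open>The correction at \<open>k = 0\<close> makes the formula uniform, so that summing over \<open>k\<close> gives two
  geometric series and a constant 1.\<close>

lemma main_coeff_prime_power:
  assumes "prime q"
  shows "main_coeff p (q ^ k) =
    (1 - 1 / real q)\<^sup>2 * ((1 / real q ^ (p + 2)) ^ k - (1 / real q ^ 2) ^ k) + (if k = 0 then 1 else 0)"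
proof (cases "k = 0")
  case False
  then have "prime_factors (q ^ k) = {q}"
    using assms by (simp add: prime_factorization_prime_power prime_factorization_prime)
  moreover have "multiplicity q (q ^ k) = k"
    using assms by simp
  moreover have "real q > 0" using assms by (simp add: prime_gt_0_nat)
  ultimately show ?thesis using False
    by (simp add: main_coeff_def unitary_coeff_def sieve_density_def power_divide
        power_add power_mult_distrib field_simps flip: power_mult)
       (auto simp: mult_2_right power_add)
qed (simp add: main_coeff_def unitary_coeff_def sieve_density_def)

text \<open>With \<open>t = 1/q\<close> and \<open>u = t\<^bsup>p+2\<^esup>\<close> the local factor is
  \<open>1 + (1-t)\<^sup>2 (1/(1-u) - 1/(1-t\<^sup>2))\<close>. Over the common denominator \<open>(1-t\<^sup>2)(1-u)\<close> the numerator
  is \<open>(1-t\<^sup>2)(1-u) + (1-t)\<^sup>2 (u-t\<^sup>2)\<close>, where the terms \<open>u\<close> cancel and \<open>beta_factor\<close> is left.\<close>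

lemma suminf_main_coeff_prime_power:
  assumes "prime q"
  shows "(\<Sum>k. main_coeff p (q ^ k)) =
    beta_factor p (real q) * (1 / (1 - 1 / real q ^ 2)) * (1 / (1 - 1 / real q ^ (p + 2)))"
proof -
  define t where "t = 1 / real q"
  define u where "u = t ^ (p + 2)"
  have q: "real q > 1" using prime_gt_1_nat[OF assms] by simp
  then have t: "0 < t" "t < 1" by (auto simp: t_def)
  have tu: "1 / real q ^ k = t ^ k" for k
    by (simp add: t_def power_divide)
  have t2: "t ^ 2 < 1" and u: "0 < u" "u < 1"
    using t power_Suc_less_one[OF t, of 1] power_Suc_less_one[OF t, of "p + 1"]
    by (auto simp: u_def power2_eq_square)
  have "(\<lambda>k. (1 - t)\<^sup>2 * (u ^ k - (t ^ 2) ^ k) + (if k = 0 then 1 else 0)) sums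
      ((1 - t)\<^sup>2 * (1 / (1 - u) - 1 / (1 - t ^ 2)) + 1)"
    using u t t2 by (intro sums_add sums_mult sums_diff geometric_sums sums_single) auto
  then have "(\<Sum>k. main_coeff p (q ^ k)) = (1 - t)\<^sup>2 * (1 / (1 - u) - 1 / (1 - t ^ 2)) + 1"
    unfolding main_coeff_prime_power[OF assms] tu by (simp add: t_def u_def sums_iff)
  also have "\<dots> = ((1 - t)\<^sup>2 * (u - t ^ 2) + (1 - t ^ 2) * (1 - u)) * (1 / (1 - t ^ 2)) * (1 / (1 - u))"
  proof -
    have "c * (1 / b - 1 / a) + 1 = (c * (a - b) + a * b) * (1 / a) * (1 / b)"
      if "a \<noteq> 0" "b \<noteq> 0" for a b c :: real
      using that by (simp add: field_simps)
    from this[of "1 - t ^ 2" "1 - u" "(1 - t)\<^sup>2"] show ?thesis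
      using t2 u by simp
  qed
  also have "(1 - t)\<^sup>2 * (u - t ^ 2) + (1 - t ^ 2) * (1 - u) =
      1 - 2 * t ^ 2 + 2 * t ^ 3 - t ^ 4 - 2 * (t * u) + 2 * (t ^ 2 * u)"
    by (simp add: power2_eq_square power3_eq_cube power4_eq_xxxx algebra_simps)
  also have "\<dots> = beta_factor p (real q)"
  proof -
    have "t * u = t ^ (p + 3)" "t ^ 2 * u = t ^ (p + 4)"
      by (simp_all add: u_def power_add power2_eq_square power3_eq_cube power4_eq_xxxx)
    moreover have "c / real q ^ k = c * t ^ k" for c k
      by (simp flip: tu)
    ultimately show ?thesis
      by (simp add: beta_factor_def tu)
  qed
  finally show ?thesis
    by (simp only: tu u_def)
qed

lemma suminf_main_coeff: "suminf (main_coeff p) = beta_const p"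
proof (rule LIMSEQ_unique)
  have "(\<lambda>N. \<Prod>q\<le>N. if prime q then (\<Sum>k. main_coeff p (q ^ k)) else 1) \<longlonglongrightarrow> suminf (main_coeff p)"
  proof (rule euler_product)
    fix q k m :: nat
    assume "prime q" "\<not> q dvd m"
    then show "main_coeff p (q ^ k * m) = main_coeff p (q ^ k) * main_coeff p m"
      by (intro main_coeff_coprime_mult)
         (auto simp: prime_gt_0_nat prime_imp_coprime intro!: Nat.gr0I coprime_power_left_iff[THEN iffD2])
  qed (simp_all add: summable_abs_main_coeff, simp_all add: main_coeff_def unitary_coeff_def sieve_density_def)
  moreover have "(\<Prod>q\<le>N. if prime q then (\<Sum>k. main_coeff p (q ^ k)) else 1) =
      (\<Prod>q\<le>N. if prime q then 1 / (1 - 1 / real q ^ 2) else 1) *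
      (\<Prod>q\<le>N. if prime q then 1 / (1 - 1 / real q ^ (p + 2)) else 1) *
      (\<Prod>q\<le>N. if prime q then beta_factor p (real q) else 1)" for N
    unfolding prod.distrib[symmetric]
    by (intro prod.cong refl) (simp add: suminf_main_coeff_prime_power)
  ultimately show "(\<lambda>N. (\<Prod>q\<le>N. if prime q then 1 / (1 - 1 / real q ^ 2) else 1) *
      (\<Prod>q\<le>N. if prime q then 1 / (1 - 1 / real q ^ (p + 2)) else 1) *
      (\<Prod>q\<le>N. if prime q then beta_factor p (real q) else 1)) \<longlonglongrightarrow> suminf (main_coeff p)"
    by simp
  have "(\<lambda>N. \<Prod>q\<le>N. if prime q then beta_factor p (real q) else 1) \<longlonglongrightarrow>
      (\<Prod>q. if prime q then beta_factor p (real q) else 1)"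
    by (intro convergent_prod_LIMSEQ abs_convergent_prod_imp_convergent_prod abs_convergent_prod_beta)
  with zeta_euler_product[of 2] zeta_euler_product[of "p + 2"]
  show "(\<lambda>N. (\<Prod>q\<le>N. if prime q then 1 / (1 - 1 / real q ^ 2) else 1) *
      (\<Prod>q\<le>N. if prime q then 1 / (1 - 1 / real q ^ (p + 2)) else 1) *
      (\<Prod>q\<le>N. if prime q then beta_factor p (real q) else 1)) \<longlonglongrightarrow> beta_const p"
    unfolding beta_const_def by (intro tendsto_mult) (simp_all add: add.commute)
qed

text \<open>Comparison with the telescoping series of \<open>1/(n(n+1))\<close>.\<close>

lemma suminf_tail_le:
  fixes f :: "nat \<Rightarrow> real"
  assumes "N \<ge> 1" and bound: "\<And>n. \<bar>f n\<bar> \<le> 1 / real n ^ 2"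
  shows "\<bar>suminf f - (\<Sum>n = 1..N. f n)\<bar> \<le> 1 / real N"
proof -
  let ?T = "\<lambda>n. 1 / real (n + N)"
  have f0: "f 0 = 0" using bound[of 0] by simp
  have "?T \<longlonglongrightarrow> 0"
    by (intro LIMSEQ_ignore_initial_segment lim_1_over_n)
  then have T: "(\<lambda>n. ?T n - ?T (Suc n)) sums (1 / real N)"
    using telescope_sums'[of ?T 0] by simp
  have le: "\<bar>f (n + Suc N)\<bar> \<le> ?T n - ?T (Suc n)" for n
  proof -
    have "\<bar>f (n + Suc N)\<bar> \<le> 1 / (real (n + N) + 1) ^ 2"
      using bound[of "n + Suc N"] by (simp add: algebra_simps)
    also have "\<dots> \<le> 1 / (real (n + N) * (real (n + N) + 1))"
      using assms(1) by (intro divide_left_mono) (auto simp: power2_eq_square intro!: mult_right_mono)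
    also have "\<dots> = ?T n - ?T (Suc n)"
      using assms(1) by (simp add: field_simps)
    finally show ?thesis .
  qed
  have tail: "summable (\<lambda>n. \<bar>f (n + Suc N)\<bar>)"
    by (rule summable_comparison_test'[OF sums_summable[OF T]]) (use le in simp)
  then have "summable (\<lambda>n. f (n + Suc N))"
    by (rule summable_rabs_cancel)
  then have "summable f"
    by (rule summable_iff_shift[THEN iffD1])
  then have "suminf f - (\<Sum>n<Suc N. f n) = (\<Sum>n. f (n + Suc N))"
    by (rule suminf_minus_initial_segment[symmetric])
  moreover have "(\<Sum>n<Suc N. f n) = (\<Sum>n = 1..N. f n)"
    using f0 by (intro sum.mono_neutral_right) (auto simp: Suc_le_eq)
  moreover have "\<bar>\<Sum>n. f (n + Suc N)\<bar> \<le> (\<Sum>n. \<bar>f (n + Suc N)\<bar>)"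
    by (rule summable_rabs[OF tail])
  moreover have "(\<Sum>n. \<bar>f (n + Suc N)\<bar>) \<le> 1 / real N"
    unfolding sums_unique[OF T] by (intro suminf_le le tail sums_summable[OF T])
  ultimately show ?thesis by simp
qed

section \<open>The asymptotic formula\<close>

text \<open>The two conditions on \<open>d\<close> are encoded in separate factors, so that after interchanging the
  summations the sums over \<open>i\<close> and \<open>j\<close> separate into a square.\<close>

lemma lcum_power_eq:
  assumes "i \<in> {1..N}" "j \<in> {1..N}"
  shows "real (lcum i j) ^ p = (\<Sum>d = 1..N. unitary_coeff p d *
    (if unitary_dvd d i then real i ^ p else 0) * (if unitary_dvd d j then real j ^ p else 0))"
proof -
  have i: "i > 0" and j: "j > 0" using assms by auto
  have g: "gcud i j > 0"
    using unitary_dvd_gcud1[OF i, of j] i by (auto simp: unitary_dvd_def intro!: gr0I)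
  have sub: "{d. unitary_dvd d (gcud i j)} \<subseteq> {1..N}"
  proof
    fix d assume "d \<in> {d. unitary_dvd d (gcud i j)}"
    then have "d dvd i" using unitary_dvd_gcud_iff[OF i j] by (auto simp: unitary_dvd_def)
    then show "d \<in> {1..N}" using assms(1) by (auto dest: dvd_imp_le intro: gr0I simp: Suc_le_eq)
  qed
  have "real (lcum i j) ^ p = real i ^ p * real j ^ p * (1 / real (gcud i j) ^ p)"
    by (simp add: of_nat_lcum[OF i] power_mult_distrib power_divide)
  also have "1 / real (gcud i j) ^ p = (\<Sum>d | unitary_dvd d (gcud i j). unitary_coeff p d)"
    by (rule sum_unitary_coeff[OF g, symmetric])
  also have "\<dots> = (\<Sum>d = 1..N. if unitary_dvd d (gcud i j) then unitary_coeff p d else 0)"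
    using sub by (intro sum.mono_neutral_cong_left) auto
  finally show ?thesis
    unfolding unitary_dvd_gcud_iff[OF i j] sum_distrib_left
    by (simp add: if_distrib cong: sum.cong) (auto intro!: sum.cong)
qed

lemma sum_lcum_power_eq:
  "(\<Sum>i | 0 < i \<and> real i \<le> x. \<Sum>j | 0 < j \<and> real j \<le> x. real (lcum i j) ^ p) =
    (\<Sum>d = 1..nat \<lfloor>x\<rfloor>. unitary_coeff p d * unitary_power_sum p d x ^ 2)"
proof -
  let ?N = "nat \<lfloor>x\<rfloor>"
  let ?g = "\<lambda>d i. if unitary_dvd d i then real i ^ p else 0"
  have A: "unitary_power_sum p d x = (\<Sum>i = 1..?N. ?g d i)" for d
  proof -
    have "{i. 0 < i \<and> real i \<le> x \<and> unitary_dvd d i} = {i \<in> {1..?N}. unitary_dvd d i}"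
      using nat_interval_real[of x] by blast
    then show ?thesis
      unfolding unitary_power_sum_def by (simp only: sum.inter_filter[OF finite_atLeastAtMost])
  qed
  have "(\<Sum>i | 0 < i \<and> real i \<le> x. \<Sum>j | 0 < j \<and> real j \<le> x. real (lcum i j) ^ p) =
      (\<Sum>i = 1..?N. \<Sum>j = 1..?N. \<Sum>d = 1..?N. unitary_coeff p d * ?g d i * ?g d j)"
    unfolding nat_interval_real by (intro sum.cong refl lcum_power_eq)
  also have "\<dots> = (\<Sum>i = 1..?N. \<Sum>d = 1..?N. \<Sum>j = 1..?N. unitary_coeff p d * ?g d i * ?g d j)"
    by (intro sum.cong refl sum.swap)
  also have "\<dots> = (\<Sum>d = 1..?N. \<Sum>i = 1..?N. \<Sum>j = 1..?N. unitary_coeff p d * ?g d i * ?g d j)"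
    by (rule sum.swap)
  also have "\<dots> = (\<Sum>d = 1..?N. unitary_coeff p d * unitary_power_sum p d x ^ 2)"
    by (simp only: A power2_eq_square sum_product) (simp only: sum_distrib_left mult.assoc)
  finally show ?thesis .
qed

lemma harm_le_ln: "n > 0 \<Longrightarrow> harm n \<le> 1 + ln (real n)"
  using decseqD[OF decseq_harm_diff_ln, of 0 "n - 1"] by (simp add: harm_def)

text \<open>Counting \<open>2\<^bsup>\<omega>(d)\<^esup>\<close> as the number of unitary divisors \<open>e\<close> of \<open>d\<close>, each term \<open>1 / d\<close> factors as
  \<open>1 / (e f)\<close> with \<open>f = d / e\<close>, and distinct \<open>(d, e)\<close> give distinct pairs \<open>(e, f)\<close>.\<close>

lemma sum_two_power_omega_div_le:
  "(\<Sum>d = 1..N. 2 ^ card (prime_factors d) / real d) \<le> harm N ^ 2"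
proof -
  let ?D = "\<lambda>d. {e. unitary_dvd e d}"
  let ?h = "\<lambda>(d, e). (e, d div e)"
  have "(\<Sum>d = 1..N. 2 ^ card (prime_factors d) / real d) = (\<Sum>d = 1..N. \<Sum>e\<in>?D d. 1 / real d)"
    by (intro sum.cong refl) (simp add: card_unitary_divisors flip: of_nat_power)
  also have "\<dots> = (\<Sum>(d, e)\<in>Sigma {1..N} ?D. 1 / real d)"
  proof (rule sum.Sigma)
    show "\<forall>d\<in>{1..N}. finite (?D d)"
      using finite_divisors_nat by (auto simp: unitary_dvd_def intro: finite_subset[rotated])
  qed simp
  also have "\<dots> = (\<Sum>(e, f)\<in>?h ` Sigma {1..N} ?D. 1 / (real e * real f))"
  proof (subst sum.reindex)
    show "inj_on ?h (Sigma {1..N} ?D)"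
    proof (rule inj_onI)
      fix u v assume uv: "u \<in> Sigma {1..N} ?D" "v \<in> Sigma {1..N} ?D" "?h u = ?h v"
      obtain d e d' e' where "u = (d, e)" "v = (d', e')" by (cases u, cases v)
      with uv show "u = v"
        by (auto simp: unitary_dvd_def)
    qed
    show "(\<Sum>(d, e)\<in>Sigma {1..N} ?D. 1 / real d) =
        (\<Sum>x\<in>Sigma {1..N} ?D. ((\<lambda>(e, f). 1 / (real e * real f)) \<circ> ?h) x)"
    proof (intro sum.cong refl)
      fix x assume "x \<in> Sigma {1..N} ?D"
      then obtain d e where x: "x = (d, e)" "e dvd d" by (auto simp: unitary_dvd_def)
      then have "real d = real e * real (d div e)"
        by (metis dvd_mult_div_cancel of_nat_mult)
      with x show "(case x of (d, e) \<Rightarrow> 1 / real d) = ((\<lambda>(e, f). 1 / (real e * real f)) \<circ> ?h) x"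
        by simp
    qed
  qed
  also have "\<dots> \<le> (\<Sum>(e, f)\<in>{1..N} \<times> {1..N}. 1 / (real e * real f))"
  proof (rule sum_mono2)
    show "?h ` Sigma {1..N} ?D \<subseteq> {1..N} \<times> {1..N}"
    proof clarify
      fix d e assume d: "d \<in> {1..N}" "unitary_dvd e d"
      then obtain f where "d = e * f" by (auto simp: unitary_dvd_def)
      moreover from this d have "e > 0" "f > 0" by auto
      ultimately have "d div e = f" "e \<le> d" "f \<le> d" by simp_all
      with d \<open>e > 0\<close> \<open>f > 0\<close> show "e \<in> {1..N} \<and> d div e \<in> {1..N}"
        by auto
    qed
  qed auto
  also have "\<dots> = harm N ^ 2"
    by (simp add: harm_def power2_eq_square sum_product sum.cartesian_product inverse_eq_divide)
  finally show ?thesis .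
qed

text \<open>Factor the difference of squares. The sum \<open>A + B\<close> has size \<open>x\<^bsup>p+1\<^esup> / d\<close>, so only
  one factor \<open>2\<^bsup>\<omega>(d)\<^esup>\<close> enters.\<close>

lemma unitary_power_sum_square_asymp:
  assumes "d > 0" "x \<ge> 0"
  shows "\<bar>unitary_power_sum p d x ^ 2 - (sieve_density d * x ^ (p + 1) / (real p + 1) / real d) ^ 2\<bar>
    \<le> 2 * x ^ (2 * p + 1) * (2 ^ card (prime_factors d) / real d)"
proof -
  let ?A = "unitary_power_sum p d x" and ?B = "sieve_density d * x ^ (p + 1) / (real p + 1) / real d"
  have "?B \<le> 1 * x ^ (p + 1) / 1 / real d"
    using assms sieve_density_bounds by (intro divide_right_mono frac_le mult_right_mono) auto
  then have "?B \<le> x ^ (p + 1) / real d"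
    by simp
  moreover have "?B \<ge> 0"
    using assms sieve_density_bounds by simp
  ultimately have "\<bar>?A + ?B\<bar> \<le> 2 * (x ^ (p + 1) / real d)"
    using unitary_power_sum_bounds[OF assms, of p] by linarith
  moreover have "\<bar>?A - ?B\<bar> \<le> 2 ^ card (prime_factors d) * x ^ p"
    by (rule unitary_power_sum_asymp[OF assms])
  ultimately have "\<bar>?A - ?B\<bar> * \<bar>?A + ?B\<bar> \<le> (2 ^ card (prime_factors d) * x ^ p) * (2 * (x ^ (p + 1) / real d))"
    by (intro mult_mono) (use assms in auto)
  also have "\<dots> = 2 * x ^ (2 * p + 1) * (2 ^ card (prime_factors d) / real d)"
  proof -
    have "x ^ (2 * p + 1) = x ^ p * x ^ (p + 1)"
      by (simp only: power_add[symmetric] mult_2 add.assoc)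
    then show ?thesis by (simp only:) (simp add: mult_ac)
  qed
  also have "\<bar>?A - ?B\<bar> * \<bar>?A + ?B\<bar> = \<bar>?A ^ 2 - ?B ^ 2\<bar>"
  proof -
    have "(a - b) * (a + b) = a ^ 2 - b ^ 2" for a b :: real
      by (simp add: power2_eq_square algebra_simps)
    then show ?thesis
      unfolding abs_mult[symmetric] by (rule arg_cong)
  qed
  finally show ?thesis .
qed

text \<open>The threshold 3 exceeds \<open>e\<close>, so that \<open>ln x \<ge> 1\<close> and all lower order terms are absorbed by
  \<open>(ln x)\<^sup>2\<close>. Of the constant 10, the errors of the \<open>A\<^sub>d\<close> use 8 and the tail of the series for
  \<open>\<beta>\<^sub>p\<close> uses 2.\<close>

lemma sum_lcum_power_error:
  assumes "x \<ge> 3"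
  shows "\<bar>(\<Sum>i | 0 < i \<and> real i \<le> x. \<Sum>j | 0 < j \<and> real j \<le> x. real (lcum i j) ^ p)
      - beta_const p / (real p + 1) ^ 2 * x ^ (2 * (p + 1))\<bar> \<le> 10 * (x ^ (2 * p + 1) * (ln x) ^ 2)"
proof -
  define N where "N = nat \<lfloor>x\<rfloor>"
  define K where "K = (x ^ (p + 1) / (real p + 1)) ^ 2"
  define B where "B d = sieve_density d * x ^ (p + 1) / (real p + 1) / real d" for d
  have N: "N \<ge> 1" "real N \<le> x" "x \<le> 2 * real N"
    using assms unfolding N_def by linarith+
  have ln: "ln x \<ge> 1"
    using assms exp_le by (subst ln_ge_iff) auto
  have K: "K \<ge> 0" "K = x ^ (2 * (p + 1)) / (real p + 1) ^ 2" "K \<le> x ^ (2 * (p + 1))"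
  proof -
    show K: "K = x ^ (2 * (p + 1)) / (real p + 1) ^ 2"
      by (simp only: K_def power_divide power_mult[symmetric] mult.commute[of 2 "p + 1"])
    show "K \<ge> 0" by (simp add: K_def)
    have "1 \<le> (real p + 1) ^ 2" by (simp add: one_le_power)
    then show "K \<le> x ^ (2 * (p + 1))"
      unfolding K using divide_left_mono[of 1 "(real p + 1) ^ 2" "x ^ (2 * (p + 1))"] assms by simp
  qed
  \<comment> \<open>\<open>B d\<close> is the main term of \<open>A\<^sub>d(x)\<close>; its square carries \<open>main_coeff\<close>.\<close>
  have main: "(\<Sum>d = 1..N. unitary_coeff p d * B d ^ 2) = K * (\<Sum>d = 1..N. main_coeff p d)"
    unfolding sum_distrib_left
    by (intro sum.cong refl) (simp add: B_def K_def main_coeff_def power_mult_distrib power_divide)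
  have "\<bar>\<Sum>d = 1..N. unitary_coeff p d * (unitary_power_sum p d x ^ 2 - B d ^ 2)\<bar>
      \<le> (\<Sum>d = 1..N. 2 * x ^ (2 * p + 1) * (2 ^ card (prime_factors d) / real d))"
  proof (rule order_trans[OF sum_abs], rule sum_mono)
    fix d assume "d \<in> {1..N}"
    then have "\<bar>unitary_power_sum p d x ^ 2 - B d ^ 2\<bar>
        \<le> 2 * x ^ (2 * p + 1) * (2 ^ card (prime_factors d) / real d)"
      unfolding B_def using assms by (intro unitary_power_sum_square_asymp) auto
    then show "\<bar>unitary_coeff p d * (unitary_power_sum p d x ^ 2 - B d ^ 2)\<bar>
        \<le> 2 * x ^ (2 * p + 1) * (2 ^ card (prime_factors d) / real d)"
      unfolding abs_mult using abs_unitary_coeff_le_1[of p d]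
      by (meson abs_ge_zero mult_left_le_one_le order_trans)
  qed
  also have "\<dots> = 2 * x ^ (2 * p + 1) * (\<Sum>d = 1..N. 2 ^ card (prime_factors d) / real d)"
    by (simp only: sum_distrib_left)
  also have "\<dots> \<le> 2 * x ^ (2 * p + 1) * (2 * ln x) ^ 2"
  proof (rule mult_left_mono)
    have "harm N \<le> 1 + ln (real N)" using N by (intro harm_le_ln) simp
    also have "\<dots> \<le> 2 * ln x"
    proof -
      have "ln (real N) \<le> ln x"
        using N by (subst ln_le_cancel_iff) auto
      then show ?thesis using ln by simp
    qed
    finally have "harm N ^ 2 \<le> (2 * ln x) ^ 2"
      by (intro power_mono) (auto simp: harm_nonneg)
    with sum_two_power_omega_div_le[of N]
    show "(\<Sum>d = 1..N. 2 ^ card (prime_factors d) / real d) \<le> (2 * ln x) ^ 2" by linarith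
  qed (use assms in simp)
  also have "\<dots> = 8 * (x ^ (2 * p + 1) * (ln x) ^ 2)"
    by (simp add: power_mult_distrib)
  finally have err1: "\<bar>\<Sum>d = 1..N. unitary_coeff p d * (unitary_power_sum p d x ^ 2 - B d ^ 2)\<bar>
      \<le> 8 * (x ^ (2 * p + 1) * (ln x) ^ 2)" .
  have "K * \<bar>beta_const p - (\<Sum>d = 1..N. main_coeff p d)\<bar> \<le> x ^ (2 * (p + 1)) * (2 / x)"
  proof (intro mult_mono K)
    have "1 / real N \<le> 2 / x" using N assms by (simp add: field_simps)
    then show "\<bar>beta_const p - (\<Sum>d = 1..N. main_coeff p d)\<bar> \<le> 2 / x"
      using suminf_tail_le[OF N(1), of "main_coeff p"] abs_main_coeff_le
      by (simp add: suminf_main_coeff)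
  qed (use assms in auto)
  also have "\<dots> = 2 * x ^ (2 * p + 1)"
    using assms by simp
  also have "\<dots> \<le> 2 * (x ^ (2 * p + 1) * (ln x) ^ 2)"
    using assms ln by (simp add: one_le_power)
  finally have err2: "\<bar>K * (beta_const p - (\<Sum>d = 1..N. main_coeff p d))\<bar> \<le> 2 * (x ^ (2 * p + 1) * (ln x) ^ 2)"
    using K by (simp add: abs_mult)
  have "(\<Sum>d = 1..N. unitary_coeff p d * unitary_power_sum p d x ^ 2) - beta_const p * K =
      (\<Sum>d = 1..N. unitary_coeff p d * (unitary_power_sum p d x ^ 2 - B d ^ 2))
        - K * (beta_const p - (\<Sum>d = 1..N. main_coeff p d))"
    unfolding right_diff_distrib sum_subtractf main by simp
  with err1 err2 have "\<bar>(\<Sum>d = 1..N. unitary_coeff p d * unitary_power_sum p d x ^ 2) - beta_const p * K\<bar>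
      \<le> 10 * (x ^ (2 * p + 1) * (ln x) ^ 2)"
    by linarith
  then show ?thesis
    unfolding sum_lcum_power_eq N_def[symmetric] K(2) by simp
qed

theorem theorem6p6:
  fixes p :: nat
  assumes "p \<ge> 1"
  shows "(\<lambda>x::real. (\<Sum>i | 0 < i \<and> real i \<le> x. \<Sum>j | 0 < j \<and> real j \<le> x. real (lcum i j) ^ p)
            - beta_const p / (real p + 1) ^ 2 * x ^ (2 * (p + 1)))
         \<in> O[at_top](\<lambda>x. x ^ (2 * p + 1) * (ln x) ^ 2)"
proof (rule bigoI)
  show "\<forall>\<^sub>F x in at_top. norm ((\<Sum>i | 0 < i \<and> real i \<le> x. \<Sum>j | 0 < j \<and> real j \<le> x. real (lcum i j) ^ p)
            - beta_const p / (real p + 1) ^ 2 * x ^ (2 * (p + 1)))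
         \<le> 10 * norm (x ^ (2 * p + 1) * (ln x) ^ 2)"
    using eventually_ge_at_top[of 3]
  proof eventually_elim
    case (elim x)
    show ?case
      using sum_lcum_power_error[OF elim, of p] elim by (simp add: abs_mult)
  qed
qed

end
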